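(* Let $M$ be a differentiable manifold with topology $\tau_M$. Let $d$ be a metric on $M$ such that every $p\in M$ has a $\tau_M$-neighborhood $V$ for which $d|_{V\times V}$ is Lipschitz equivalent to (the distance function of) a Finsler metric on $V$; $d$ is not required to induce $\tau_M$. Let $p\in M$, $v\in T_pM$, and suppose that there exists a curve $c:(-\varepsilon,\varepsilon)\to M$ with $c(0)=p$, $c'(0)=v$, for which the speed $$\lim_{t\to0}\frac{d(c(t),p)}{|t|}$$ exists. If $\eta:(-\varepsilon,\varepsilon)\to M$ is another curve with $\eta(0)=p$ and $\eta'(0)=v$, then $$\lim_{t\to0}\frac{d(\eta(t),p)}{|t|}=\lim_{t\to0}\frac{d(c(t),p)}{|t|}.$$
   Context: Manifolds are Hausdorff with countable basis. A Finsler metric on a manifold $V$ is a continuous function $F:TV\to\mathbb R$ whose restriction to each tangent space is a norm; its distance function is $d_F(x,y)=\inf_\gamma\int F(\gamma'(t))\,dt$ over piecewise continuously differentiable paths in $V$ connecting $x$ and $y$. Two metrics $d,\rho$ are Lipschitz equivalent if $c\,d\le\rho\le C\,d$ for some constants $c,C>0$. *)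

theory Defs
  imports "HOL-Analysis.Analysis"
begin

text \<open>
  A chart is a pair \<open>(U, \<phi>)\<close>; the values of \<open>\<phi>\<close> outside \<open>U\<close> are irrelevant. The model space
  is a finite-dimensional normed space \<open>'e\<close> rather than a \<open>euclidean_space\<close>, because that
  class excludes dimension 0.
\<close>

type_synonym ('a, 'e) chart = "'a set \<times> ('a \<Rightarrow> 'e)"

definition is_chart :: "'a topology \<Rightarrow> ('a, 'e::real_normed_vector) chart \<Rightarrow> bool" where
  "is_chart X k \<longleftrightarrow>
     openin X (fst k) \<and> open (snd k ` fst k) \<and>
     homeomorphic_map (subtopology X (fst k)) (top_of_set (snd k ` fst k)) (snd k)"

definition transition ::
  "('a, 'e::real_normed_vector) chart \<Rightarrow> ('a, 'e) chart \<Rightarrow> 'e \<Rightarrow> 'e" where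
  "transition k l = snd l \<circ> inv_into (fst k) (snd k)"

definition C1_on :: "('e::real_normed_vector \<Rightarrow> 'e) \<Rightarrow> 'e set \<Rightarrow> bool" where
  "C1_on f S \<longleftrightarrow>
     (\<exists>f' :: 'e \<Rightarrow> 'e \<Rightarrow>\<^sub>L 'e.
        (\<forall>x\<in>S. (f has_derivative blinfun_apply (f' x)) (at x)) \<and> continuous_on S f')"

text \<open>
  The atlas need not be maximal. Class \<open>C\<^sup>1\<close> is the weakest regularity for which the
  tangent bundle is a topological space, so smoother atlases are covered as well.
\<close>

definition differentiable_manifold ::
  "'a topology \<Rightarrow> ('a, 'e::real_normed_vector) chart set \<Rightarrow> bool" where
  "differentiable_manifold X A \<longleftrightarrow>
     Hausdorff_space X \<and> second_countable X \<and>
     (\<exists>B :: 'e set. finite B \<and> span B = UNIV) \<and>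
     (\<Union>k\<in>A. fst k) = topspace X \<and>
     (\<forall>k\<in>A. is_chart X k) \<and>
     (\<forall>k\<in>A. \<forall>l\<in>A. C1_on (transition k l) (snd k ` (fst k \<inter> fst l)))"

text \<open>The atlas of an open subset \<open>V\<close>, regarded as a manifold with the subspace topology.\<close>

definition restrict_atlas :: "('a, 'e) chart set \<Rightarrow> 'a set \<Rightarrow> ('a, 'e) chart set" where
  "restrict_atlas A V = (\<lambda>k. (fst k \<inter> V, snd k)) ` A"

text \<open>
  A tangent vector at \<open>p\<close> is the family of its coordinate representations in all charts around
  \<open>p\<close>, related to each other by the derivatives of the transition maps. Charts not containing
  \<open>p\<close> are assigned \<open>0\<close>, so that equal tangent vectors are equal as functions; the vector
  space operations are pointwise.
\<close>

type_synonym ('a, 'e) tangent = "('a, 'e) chart \<Rightarrow> 'e"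

definition tangent_space ::
  "('a, 'e::real_normed_vector) chart set \<Rightarrow> 'a \<Rightarrow> ('a, 'e) tangent set" where
  "tangent_space A p =
     {v. (\<forall>k. \<not> (k \<in> A \<and> p \<in> fst k) \<longrightarrow> v k = 0) \<and>
         (\<forall>k\<in>A. \<forall>l\<in>A. p \<in> fst k \<inter> fst l \<longrightarrow>
            v l = frechet_derivative (transition k l) (at (snd k p)) (v k))}"

definition tangent_bundle ::
  "'a topology \<Rightarrow> ('a, 'e::real_normed_vector) chart set \<Rightarrow> ('a \<times> ('a, 'e) tangent) topology"
where
  "tangent_bundle X A = topology_generated_by
     {{(p, v). p \<in> topspace X \<and> v \<in> tangent_space A p \<and> p \<in> fst k \<and> snd k p \<in> S \<and> v k \<in> T} | k S T.
        k \<in> A \<and> open S \<and> open T}"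

definition differentiable_curve_at ::
  "('a, 'e::real_normed_vector) chart set \<Rightarrow> (real \<Rightarrow> 'a) \<Rightarrow> real \<Rightarrow> bool" where
  "differentiable_curve_at A c t \<longleftrightarrow>
     (\<forall>k\<in>A. c t \<in> fst k \<longrightarrow> (snd k \<circ> c) differentiable (at t))"

definition velocity ::
  "('a, 'e::real_normed_vector) chart set \<Rightarrow> (real \<Rightarrow> 'a) \<Rightarrow> real \<Rightarrow> ('a, 'e) tangent" where
  "velocity A c t =
     (\<lambda>k. if k \<in> A \<and> c t \<in> fst k then vector_derivative (snd k \<circ> c) (at t) else 0)"

definition finsler_metric ::
  "'a topology \<Rightarrow> ('a, 'e::real_normed_vector) chart set \<Rightarrow> ('a \<times> ('a, 'e) tangent \<Rightarrow> real) \<Rightarrow> bool"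
where
  "finsler_metric X A F \<longleftrightarrow>
     continuous_map (tangent_bundle X A) euclideanreal F \<and>
     (\<forall>p\<in>topspace X. \<forall>v\<in>tangent_space A p.
        F (p, v) \<ge> 0 \<and>
        (F (p, v) = 0 \<longleftrightarrow> v = (\<lambda>_. 0)) \<and>
        (\<forall>a. F (p, \<lambda>k. a *\<^sub>R v k) = \<bar>a\<bar> * F (p, v)) \<and>
        (\<forall>w\<in>tangent_space A p. F (p, \<lambda>k. v k + w k) \<le> F (p, v) + F (p, w)))"

text \<open>\<open>C\<^sup>1\<close> up to the endpoints, where the derivative is one-sided.\<close>

definition C1_curve_on ::
  "('a, 'e::real_normed_vector) chart set \<Rightarrow> (real \<Rightarrow> 'a) \<Rightarrow> real \<Rightarrow> real \<Rightarrow> bool" where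
  "C1_curve_on A g a b \<longleftrightarrow>
     (\<forall>k\<in>A. \<exists>g'.
        (\<forall>t\<in>{a..b}. g t \<in> fst k \<longrightarrow> ((snd k \<circ> g) has_vector_derivative g' t) (at t within {a..b})) \<and>
        continuous_on {t\<in>{a..b}. g t \<in> fst k} g')"

definition piecewise_C1_path ::
  "'a topology \<Rightarrow> ('a, 'e::real_normed_vector) chart set \<Rightarrow> (real \<Rightarrow> 'a) \<Rightarrow> bool" where
  "piecewise_C1_path X A g \<longleftrightarrow>
     pathin X g \<and>
     (\<exists>(n::nat) \<tau>. \<tau> 0 = 0 \<and> \<tau> n = 1 \<and>
        (\<forall>i<n. \<tau> i < \<tau> (Suc i) \<and> C1_curve_on A g (\<tau> i) (\<tau> (Suc i))))"

text \<open>
  At the finitely many break points and at the endpoints \<open>velocity\<close> may be meaningless; this does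
  not affect the integral.
\<close>

definition finsler_length ::
  "('a, 'e::real_normed_vector) chart set \<Rightarrow> ('a \<times> ('a, 'e) tangent \<Rightarrow> real) \<Rightarrow> (real \<Rightarrow> 'a) \<Rightarrow> real"
where
  "finsler_length A F g = integral {0..1} (\<lambda>t. F (g t, velocity A g t))"

text \<open>The distance is \<open>\<infinity>\<close> between points in different connected components.\<close>

definition finsler_dist ::
  "'a topology \<Rightarrow> ('a, 'e::real_normed_vector) chart set \<Rightarrow> ('a \<times> ('a, 'e) tangent \<Rightarrow> real) \<Rightarrow>
   'a \<Rightarrow> 'a \<Rightarrow> ereal"
where
  "finsler_dist X A F x y =
     (INF g \<in> {g. piecewise_C1_path X A g \<and> g 0 = x \<and> g 1 = y}. ereal (finsler_length A F g))"

definition lipschitz_equivalent_on ::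
  "'a set \<Rightarrow> ('a \<Rightarrow> 'a \<Rightarrow> real) \<Rightarrow> ('a \<Rightarrow> 'a \<Rightarrow> ereal) \<Rightarrow> bool" where
  "lipschitz_equivalent_on V d \<rho> \<longleftrightarrow>
     (\<exists>c C. 0 < c \<and> 0 < C \<and>
        (\<forall>x\<in>V. \<forall>y\<in>V. ereal (c * d x y) \<le> \<rho> x y \<and> \<rho> x y \<le> ereal (C * d x y)))"

definition locally_finsler ::
  "'a topology \<Rightarrow> ('a, 'e::real_normed_vector) chart set \<Rightarrow> ('a \<Rightarrow> 'a \<Rightarrow> real) \<Rightarrow> bool" where
  "locally_finsler X A d \<longleftrightarrow>
     (\<forall>p\<in>topspace X. \<exists>V F.
        openin X V \<and> p \<in> V \<and>
        finsler_metric (subtopology X V) (restrict_atlas A V) F \<and>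
        lipschitz_equivalent_on V d (finsler_dist (subtopology X V) (restrict_atlas A V) F))"

end

theory Submission
  imports Defs
begin

text \<open>
  Only the upper Finsler bound is needed: near \<open>p\<close>, the length of a chart segment bounds
  \<open>d\<close> by a multiple of the norm distance in the chart. Two curves with the same velocity at
  \<open>p\<close> are \<open>o(t)\<close> apart in the chart, hence \<open>o(t)\<close> apart for \<open>d\<close>, and the triangle
  inequality transfers the limit.
\<close>

section \<open>Topology of charts\<close>

lemma chart_topspace:
  assumes "is_chart X k" "q \<in> fst k"
  shows "q \<in> topspace X"
  using assms openin_subset unfolding is_chart_def by blast

lemma chart_inj:
  assumes "is_chart X k"
  shows "inj_on (snd k) (fst k)"
proof -
  have "topspace (subtopology X (fst k)) = fst k"
    using assms by (metis is_chart_def openin_subset topspace_subtopology_subset)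
  then show ?thesis
    using assms homeomorphic_imp_injective_map unfolding is_chart_def by metis
qed

lemma chart_continuous:
  assumes "is_chart X k"
  shows "continuous_map (subtopology X (fst k)) euclidean (snd k)"
  using assms unfolding is_chart_def
  by (meson continuous_map_into_fulltopology homeomorphic_imp_continuous_map)

text \<open>A chart is an open map onto its image, and that image is itself open, so relative
  openness becomes openness in the model space. Derivatives on overlaps can then be taken at full
  neighborhoods.\<close>

lemma chart_open_image:
  assumes "is_chart X k" "openin X W" "W \<subseteq> fst k"
  shows "open (snd k ` W)"
proof -
  have "openin (subtopology X (fst k)) W"
    using assms by (metis inf.absorb2 openin_subtopology_Int2)
  moreover have "open_map (subtopology X (fst k)) (top_of_set (snd k ` fst k)) (snd k)"
    using assms(1) homeomorphic_imp_open_map unfolding is_chart_def by blast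
  ultimately have "openin (top_of_set (snd k ` fst k)) (snd k ` W)"
    unfolding open_map_def by blast
  then show ?thesis
    using assms(1) openin_open_trans unfolding is_chart_def by blast
qed

lemma chart_inv_continuous:
  assumes "is_chart X k"
  shows "continuous_map (top_of_set (snd k ` fst k)) X (inv_into (fst k) (snd k))"
proof -
  have ts: "topspace (subtopology X (fst k)) = fst k"
    using assms by (metis is_chart_def openin_subset topspace_subtopology_subset)
  \<comment> \<open>The homeomorphism supplies some inverse \<open>g\<close>; injectivity of the
    chart identifies it with \<open>inv_into\<close> on the image, so continuity carries
    over.\<close>
  obtain g where "homeomorphic_maps (subtopology X (fst k)) (top_of_set (snd k ` fst k)) (snd k) g"
    using assms unfolding is_chart_def homeomorphic_map_maps by blast
  then have g: "continuous_map (top_of_set (snd k ` fst k)) (subtopology X (fst k)) g"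
    "\<forall>q \<in> fst k. g (snd k q) = q"
    using ts unfolding homeomorphic_maps_def by auto
  have "continuous_map (top_of_set (snd k ` fst k)) X g"
    using g(1) continuous_map_into_fulltopology by blast
  then show ?thesis
    by (rule continuous_map_eq) (use g(2) chart_inj[OF assms] in auto)
qed

lemma transition_chart:
  assumes "is_chart X k" "q \<in> fst k"
  shows "transition k l (snd k q) = snd l q"
  using chart_inj[OF assms(1)] assms(2) by (simp add: transition_def)

text \<open>Translates continuity into an abstract topology into a statement about filters on the
  parameter space, which is the form that limits and derivatives require.\<close>

lemma continuous_map_eventually_nhds:
  assumes "continuous_map (top_of_set S) X g" "open S" "t \<in> S" "openin X W" "g t \<in> W"
  shows "\<forall>\<^sub>F s in nhds t. g s \<in> W"
proof -
  have "openin (top_of_set S) {s \<in> S. g s \<in> W}"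
    using openin_continuous_map_preimage[OF assms(1,4)] by simp
  then have "open {s \<in> S. g s \<in> W}"
    using assms(2) openin_open_trans by blast
  then show ?thesis
    using assms(3,5) unfolding eventually_nhds by blast
qed

section \<open>Transition maps and tangent vectors\<close>

text \<open>A locale, so that the same facts can be instantiated both for the manifold and for an
  open subset with its restricted atlas.\<close>

locale C1_manifold =
  fixes X :: "'a topology" and A :: "('a, 'e::real_normed_vector) chart set"
  assumes manifold: "differentiable_manifold X A"
begin

lemma chart: "k \<in> A \<Longrightarrow> is_chart X k"
  using manifold unfolding differentiable_manifold_def by blast

lemma chart_openin: "k \<in> A \<Longrightarrow> openin X (fst k)"
  using chart unfolding is_chart_def by blast

lemma open_overlap:
  assumes "k \<in> A" "l \<in> A"
  shows "open (snd k ` (fst k \<inter> fst l))"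
  using assms chart_openin by (intro chart_open_image[OF chart] openin_Int) auto

text \<open>By injectivity of \<open>snd k\<close>, membership of a point in a second chart can be
  read off from its coordinates in the first.\<close>

lemma overlap_iff:
  assumes "k \<in> A" "q \<in> fst k"
  shows "snd k q \<in> snd k ` (fst k \<inter> fst l) \<longleftrightarrow> q \<in> fst l"
  using chart_inj[OF chart[OF assms(1)]] assms(2) by (auto simp: inj_on_def)

text \<open>Tangent vectors are defined with \<open>frechet_derivative\<close>, a choice operator,
  whereas \<open>C1_on\<close> only asserts that a continuous derivative exists. Uniqueness of
  derivatives identifies the two, which gives access to linearity and to continuity in the base
  point.\<close>

lemma transition_frechet:
  assumes "k \<in> A" "l \<in> A"
  obtains T :: "'e \<Rightarrow> 'e \<Rightarrow>\<^sub>L 'e"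
  where "continuous_on (snd k ` (fst k \<inter> fst l)) T"
    and "\<And>q. q \<in> fst k \<Longrightarrow> q \<in> fst l \<Longrightarrow>
      (transition k l has_derivative blinfun_apply (T (snd k q))) (at (snd k q))"
    and "\<And>q. q \<in> fst k \<Longrightarrow> q \<in> fst l \<Longrightarrow>
      frechet_derivative (transition k l) (at (snd k q)) = blinfun_apply (T (snd k q))"
proof -
  have "C1_on (transition k l) (snd k ` (fst k \<inter> fst l))"
    using manifold assms unfolding differentiable_manifold_def by blast
  then obtain T :: "'e \<Rightarrow> 'e \<Rightarrow>\<^sub>L 'e" where T: "continuous_on (snd k ` (fst k \<inter> fst l)) T"
    "\<And>x. x \<in> snd k ` (fst k \<inter> fst l) \<Longrightarrow>
      (transition k l has_derivative blinfun_apply (T x)) (at x)"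
    unfolding C1_on_def by blast
  show thesis
  proof (rule that[OF T(1)])
    fix q assume "q \<in> fst k" "q \<in> fst l"
    then show "(transition k l has_derivative blinfun_apply (T (snd k q))) (at (snd k q))"
      using T(2) by blast
    then show "frechet_derivative (transition k l) (at (snd k q)) = blinfun_apply (T (snd k q))"
      using frechet_derivative_at by metis
  qed
qed

lemma tangent_zero:
  assumes "q \<in> topspace X"
  shows "(\<lambda>_. 0) \<in> tangent_space A q"
proof -
  have "0 = frechet_derivative (transition k l) (at (snd k q)) 0"
    if kl: "k \<in> A" "l \<in> A" "q \<in> fst k \<inter> fst l" for k l
  proof -
    obtain D where "frechet_derivative (transition k l) (at (snd k q)) = blinfun_apply D"
      by (rule transition_frechet[OF kl(1,2)]) (use kl(3) that in blast)
    then show ?thesis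
      by (simp add: blinfun.zero_right)
  qed
  then show ?thesis
    unfolding tangent_space_def by simp
qed

lemma tangent_scale:
  assumes "v \<in> tangent_space A q"
  shows "(\<lambda>k. a *\<^sub>R v k) \<in> tangent_space A q"
proof -
  have "a *\<^sub>R v l = frechet_derivative (transition k l) (at (snd k q)) (a *\<^sub>R v k)"
    if kl: "k \<in> A" "l \<in> A" "q \<in> fst k \<inter> fst l" for k l
  proof -
    have "v l = frechet_derivative (transition k l) (at (snd k q)) (v k)"
      using assms kl unfolding tangent_space_def by blast
    moreover obtain D where "frechet_derivative (transition k l) (at (snd k q)) = blinfun_apply D"
      by (rule transition_frechet[OF kl(1,2)]) (use kl(3) that in blast)
    ultimately show ?thesis
      by (simp add: blinfun.scaleR_right)
  qed
  moreover have "\<And>k. \<not> (k \<in> A \<and> q \<in> fst k) \<Longrightarrow> a *\<^sub>R v k = 0"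
    using assms unfolding tangent_space_def by auto
  ultimately show ?thesis
    unfolding tangent_space_def by blast
qed

section \<open>Finsler metrics near a zero vector\<close>

text \<open>The generators of the bundle topology constrain coordinates in arbitrary charts, while
  the later estimates use the single chart \<open>k\<close>. Induction over the generated topology
  reduces the claim to one generator, where the transition map and its derivative convert the
  constraints into chart \<open>k\<close>.\<close>

lemma tangent_bundle_nhd:
  assumes "openin (tangent_bundle X A) W" and "k \<in> A" "p \<in> fst k" "(p, \<lambda>_. 0) \<in> W"
  obtains r where "r > 0"
    and "\<And>q v. q \<in> fst k \<Longrightarrow> v \<in> tangent_space A q \<Longrightarrow> dist (snd k q) (snd k p) < r \<Longrightarrow>
      norm (v k) < r \<Longrightarrow> (q, v) \<in> W"
proof -
  let ?\<B> = "{{(p, v). p \<in> topspace X \<and> v \<in> tangent_space A p \<and> p \<in> fst k \<and> snd k p \<in> S \<and> v k \<in> T}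
    | k S T. k \<in> A \<and> open S \<and> open T}"
  \<comment> \<open>Membership of the zero vector at \<open>p\<close> is a premise inside the
    predicate, since a set arising during the induction, such as a member of a union, may miss
    it.\<close>
  let ?P = "\<lambda>W. (p, \<lambda>_. 0) \<in> W \<longrightarrow> (\<exists>r>0. \<forall>q v. q \<in> fst k \<longrightarrow> v \<in> tangent_space A q \<longrightarrow>
      dist (snd k q) (snd k p) < r \<longrightarrow> norm (v k) < r \<longrightarrow> (q, v) \<in> W)"
  have "generate_topology_on ?\<B> W"
    using assms(1) unfolding tangent_bundle_def openin_topology_generated_by_iff .
  then have "?P W"
  proof induction
    case Empty
    then show ?case by simp
  next
    case (Int a b)
    show ?case
    proof
      assume "(p, \<lambda>_. 0) \<in> a \<inter> b"
      then obtain r s where r: "r > 0" "\<forall>q v. q \<in> fst k \<longrightarrow> v \<in> tangent_space A q \<longrightarrow>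
          dist (snd k q) (snd k p) < r \<longrightarrow> norm (v k) < r \<longrightarrow> (q, v) \<in> a"
        and s: "s > 0" "\<forall>q v. q \<in> fst k \<longrightarrow> v \<in> tangent_space A q \<longrightarrow>
          dist (snd k q) (snd k p) < s \<longrightarrow> norm (v k) < s \<longrightarrow> (q, v) \<in> b"
        using Int.IH by auto
      show "\<exists>r>0. \<forall>q v. q \<in> fst k \<longrightarrow> v \<in> tangent_space A q \<longrightarrow>
          dist (snd k q) (snd k p) < r \<longrightarrow> norm (v k) < r \<longrightarrow> (q, v) \<in> a \<inter> b"
        by (rule exI[of _ "min r s"]) (use r s in auto)
    qed
  next
    case (UN K)
    show ?case
    proof
      assume "(p, \<lambda>_. 0) \<in> \<Union>K"
      then obtain W where "W \<in> K" "(p, \<lambda>_. 0) \<in> W"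
        by blast
      with UN.IH[of W] show "\<exists>r>0. \<forall>q v. q \<in> fst k \<longrightarrow> v \<in> tangent_space A q \<longrightarrow>
          dist (snd k q) (snd k p) < r \<longrightarrow> norm (v k) < r \<longrightarrow> (q, v) \<in> \<Union>K"
        by blast
    qed
  next
    case (Basis B)
    then obtain l S T where l: "l \<in> A" "open S" "open T" and B: "B = {(p, v). p \<in> topspace X \<and>
        v \<in> tangent_space A p \<and> p \<in> fst l \<and> snd l p \<in> S \<and> v l \<in> T}"
      by blast
    show ?case
    proof
      assume "(p, \<lambda>_. 0) \<in> B"
      then have p: "p \<in> fst l" "snd l p \<in> S" "0 \<in> T"
        using B by auto
      obtain D where D: "continuous_on (snd k ` (fst k \<inter> fst l)) D"
        "\<And>q. q \<in> fst k \<Longrightarrow> q \<in> fst l \<Longrightarrow>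
          (transition k l has_derivative blinfun_apply (D (snd k q))) (at (snd k q))"
        "\<And>q. q \<in> fst k \<Longrightarrow> q \<in> fst l \<Longrightarrow>
          frechet_derivative (transition k l) (at (snd k q)) = blinfun_apply (D (snd k q))"
        by (rule transition_frechet[OF assms(2) l(1)]) (rule that)
      let ?O = "snd k ` (fst k \<inter> fst l)"
      have O: "open ?O" "snd k p \<in> ?O"
        using open_overlap[OF assms(2) l(1)] assms(3) p(1) by auto
      have "\<forall>\<^sub>F y in nhds (snd k p). y \<in> ?O"
        using O eventually_nhds by blast
      moreover have "\<forall>\<^sub>F y in nhds (snd k p). transition k l y \<in> S"
      proof -
        have "isCont (transition k l) (snd k p)"
          using D(2)[OF assms(3) p(1)] has_derivative_continuous by blast
        then have "(transition k l \<longlongrightarrow> transition k l (snd k p)) (nhds (snd k p))"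
          by (simp add: continuous_at tendsto_at_iff_tendsto_nhds)
        then show ?thesis
          by (rule topological_tendstoD[OF _ l(2)])
            (simp add: p(2) transition_chart[OF chart[OF assms(2)] assms(3)])
      qed
      \<comment> \<open>The radius \<open>r1\<close> controls the base point: it must stay in the
        overlap and its \<open>l\<close>-coordinates in \<open>S\<close>.\<close>
      ultimately have "\<forall>\<^sub>F y in nhds (snd k p). y \<in> ?O \<and> transition k l y \<in> S"
        by eventually_elim simp
      then obtain r1 where r1: "r1 > 0"
        "\<And>y. dist y (snd k p) < r1 \<Longrightarrow> y \<in> ?O \<and> transition k l y \<in> S"
        unfolding eventually_nhds_metric by blast
      \<comment> \<open>The radius \<open>r2\<close> controls the vector: its
        \<open>l\<close>-coordinate depends jointly continuously on the base point and the
        \<open>k\<close>-coordinate, and at the zero vector it equals \<open>0\<close>, which lies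
        in \<open>T\<close>.\<close>
      have "\<forall>\<^sub>F z in nhds (snd k p, 0). blinfun_apply (D (fst z)) (snd z) \<in> T"
      proof -
        have "isCont D (snd k p)"
          using D(1) O continuous_on_eq_continuous_at by blast
        then have "(D \<longlongrightarrow> D (snd k p)) (nhds (snd k p))"
          by (simp add: continuous_at tendsto_at_iff_tendsto_nhds)
        then have "((\<lambda>z. D (fst z)) \<longlongrightarrow> D (snd k p)) (nhds (snd k p, 0::'e))"
          unfolding nhds_prod by (rule filterlim_compose) (rule filterlim_fst)
        moreover have "(snd \<longlongrightarrow> 0) (nhds (snd k p, 0::'e))"
          unfolding nhds_prod by (rule filterlim_snd)
        ultimately have "((\<lambda>z. blinfun_apply (D (fst z)) (snd z)) \<longlongrightarrow> blinfun_apply (D (snd k p)) 0)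
            (nhds (snd k p, 0))"
          by (rule blinfun.tendsto)
        then show ?thesis
          by (rule topological_tendstoD[OF _ l(3)]) (simp add: p(3) blinfun.zero_right)
      qed
      then obtain r2 where r2: "r2 > 0"
        "\<And>z. dist z (snd k p, 0) < r2 \<Longrightarrow> blinfun_apply (D (fst z)) (snd z) \<in> T"
        unfolding eventually_nhds_metric by blast
      show "\<exists>r>0. \<forall>q v. q \<in> fst k \<longrightarrow> v \<in> tangent_space A q \<longrightarrow>
          dist (snd k q) (snd k p) < r \<longrightarrow> norm (v k) < r \<longrightarrow> (q, v) \<in> B"
      \<comment> \<open>The distance in the product is at most the sum of the distances of the
        components, so half of \<open>r2\<close> for each suffices.\<close>
      proof (intro exI[of _ "min r1 (r2/2)"] conjI allI impI)
        fix q and v :: "('a, 'e) tangent"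
        assume q: "q \<in> fst k" "v \<in> tangent_space A q" "dist (snd k q) (snd k p) < min r1 (r2/2)"
          "norm (v k) < min r1 (r2/2)"
        have "snd k q \<in> ?O \<and> transition k l (snd k q) \<in> S"
          by (rule r1(2)) (use q(3) in simp)
        then have ql: "q \<in> fst l" and S: "snd l q \<in> S"
          using overlap_iff[OF assms(2) q(1)] transition_chart[OF chart[OF assms(2)] q(1)]
          by metis+
        have "dist (snd k q, v k) (snd k p, 0) \<le> dist (snd k q) (snd k p) + norm (v k)"
          using sqrt_sum_squares_le_sum[of "dist (snd k q) (snd k p)" "norm (v k)"]
          by (simp add: dist_Pair_Pair)
        then have "blinfun_apply (D (snd k q)) (v k) \<in> T"
          using r2(2)[of "(snd k q, v k)"] q by auto
        moreover have "v l = frechet_derivative (transition k l) (at (snd k q)) (v k)"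
          using q ql assms(2) l(1) unfolding tangent_space_def by blast
        ultimately have "v l \<in> T"
          using D(3)[OF q(1) ql] by simp
        then show "(q, v) \<in> B"
          unfolding B using q ql S chart_topspace[OF chart[OF assms(2)] q(1)] by simp
      qed (use r1 r2 in auto)
    qed
  qed
  then show thesis
    using that assms(4) by blast
qed

text \<open>Homogeneity turns continuity of \<open>F\<close> at the single point \<open>(p, 0)\<close> into a locally uniform
  bound on all tangent vectors, so no compactness of the unit sphere is needed.\<close>

lemma finsler_le_norm:
  assumes "finsler_metric X A F" "k \<in> A" "p \<in> fst k"
  obtains K r where "K > 0" "r > 0"
    and "\<And>q v. q \<in> fst k \<Longrightarrow> v \<in> tangent_space A q \<Longrightarrow> dist (snd k q) (snd k p) < r \<Longrightarrow>
      F (q, v) \<le> K * norm (v k)"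
proof -
  let ?W = "{z \<in> topspace (tangent_bundle X A). F z \<in> {..<1}}"
  have pX: "p \<in> topspace X"
    using chart_topspace[OF chart[OF assms(2)] assms(3)] .
  have cont: "continuous_map (tangent_bundle X A) euclideanreal F"
    using assms(1) unfolding finsler_metric_def by blast
  have "openin (tangent_bundle X A) ?W"
    by (rule openin_continuous_map_preimage[OF cont]) simp
  moreover have "(p, \<lambda>_. 0) \<in> ?W"
  proof -
    have "F (p, \<lambda>_. 0) = 0"
      using assms(1) tangent_zero[OF pX] pX unfolding finsler_metric_def by blast
    moreover have "(p, \<lambda>_. 0) \<in> topspace (tangent_bundle X A)"
      \<comment> \<open>The generator given by \<open>k\<close> with both open sets equal to
        \<open>UNIV\<close> contains this point.\<close>
      unfolding tangent_bundle_def topology_generated_by_topspace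
      by (rule UnionI, rule CollectI, rule exI[of _ k], rule exI[of _ UNIV], rule exI[of _ UNIV],
          rule conjI, rule refl) (use assms tangent_zero[OF pX] pX in auto)
    ultimately show ?thesis by simp
  qed
  ultimately obtain r where r: "r > 0"
    "\<And>q v. q \<in> fst k \<Longrightarrow> v \<in> tangent_space A q \<Longrightarrow> dist (snd k q) (snd k p) < r \<Longrightarrow>
      norm (v k) < r \<Longrightarrow> (q, v) \<in> ?W"
    using tangent_bundle_nhd[OF _ assms(2,3)] by blast
  have bound: "F (q, v) \<le> 2 / r * norm (v k)"
    if q: "q \<in> fst k" "v \<in> tangent_space A q" "dist (snd k q) (snd k p) < r" for q v
  proof -
    have qX: "q \<in> topspace X"
      using chart_topspace[OF chart[OF assms(2)] q(1)] .
    have scaled: "\<bar>a\<bar> * F (q, v) < 1" if "\<bar>a\<bar> * norm (v k) < r" for a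
    proof -
      have "F (q, \<lambda>k. a *\<^sub>R v k) < 1"
        using r(2)[OF q(1) tangent_scale[OF q(2), of a] q(3)] that by simp
      then show ?thesis
        using assms(1) q(2) qX unfolding finsler_metric_def by metis
    qed
    show ?thesis
    proof (cases "v k = 0")
      case True
      have "F (q, v) \<le> 0"
      proof (rule ccontr)
        assume "\<not> F (q, v) \<le> 0"
        \<comment> \<open>As \<open>v k = 0\<close>, the premise of \<open>scaled\<close> holds for
          every factor; the factor \<open>1 / F (q, v)\<close> yields \<open>1 < 1\<close>.\<close>
        then show False
          using scaled[of "1 / F (q, v)"] True r(1) by simp
      qed
      then show ?thesis
        using True by simp
    next
      case False
      \<comment> \<open>Rescaling the coordinate vector to norm \<open>r / 2\<close> keeps it within
        radius \<open>r\<close>; solving for \<open>F (q, v)\<close> produces the constant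
        \<open>2 / r\<close>.\<close>
      have "\<bar>r / (2 * norm (v k))\<bar> * F (q, v) < 1"
        by (rule scaled) (use False r(1) in simp)
      then show ?thesis
        using False r(1) by (simp add: field_simps)
    qed
  qed
  show thesis
    by (rule that[of "2 / r" r]) (use r(1) bound in auto)
qed

section \<open>Velocities and lengths of curves\<close>

text \<open>This is the chain rule applied to \<open>transition k l\<close> after
  \<open>snd k \<circ> g\<close>. That composite is known to equal \<open>snd l \<circ> g\<close>
  only where \<open>g\<close> lies in \<open>fst k\<close>, hence the assumption that
  \<open>g\<close> stays there near \<open>t\<close>.\<close>

lemma chart_change_vector_derivative:
  fixes g :: "real \<Rightarrow> 'a"
  assumes "k \<in> A" "l \<in> A" "g t \<in> fst k" "g t \<in> fst l"
    and "\<forall>\<^sub>F s in nhds t. g s \<in> fst k"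
    and "((\<lambda>s. snd k (g s)) has_vector_derivative w) (at t)"
  shows "((\<lambda>s. snd l (g s)) has_vector_derivative
    frechet_derivative (transition k l) (at (snd k (g t))) w) (at t)"
proof -
  obtain T where T: "continuous_on (snd k ` (fst k \<inter> fst l)) T"
    "\<And>q. q \<in> fst k \<Longrightarrow> q \<in> fst l \<Longrightarrow>
      (transition k l has_derivative blinfun_apply (T (snd k q))) (at (snd k q))"
    "\<And>q. q \<in> fst k \<Longrightarrow> q \<in> fst l \<Longrightarrow>
      frechet_derivative (transition k l) (at (snd k q)) = blinfun_apply (T (snd k q))"
    by (rule transition_frechet[OF assms(1,2)]) (rule that)
  define D where "D = T (snd k (g t))"
  have D: "(transition k l has_derivative blinfun_apply D) (at (snd k (g t)))"
    "frechet_derivative (transition k l) (at (snd k (g t))) = blinfun_apply D"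
    using T(2,3) assms(3,4) unfolding D_def by blast+
  have "((\<lambda>s. transition k l (snd k (g s))) has_derivative
      (\<lambda>s. blinfun_apply D (s *\<^sub>R w))) (at t)"
    using has_derivative_compose[OF assms(6)[unfolded has_vector_derivative_def] D(1)] .
  then have "((\<lambda>s. transition k l (snd k (g s))) has_vector_derivative blinfun_apply D w) (at t)"
    unfolding has_vector_derivative_def by (simp add: blinfun.scaleR_right)
  moreover obtain S where S: "open S" "t \<in> S" "\<And>s. s \<in> S \<Longrightarrow> g s \<in> fst k"
    using assms(5) unfolding eventually_nhds by blast
  ultimately show ?thesis
    unfolding D(2)
    using transition_chart[OF chart[OF assms(1)], of _ l]
      has_vector_derivative_transform_within_open[of _ _ t S "\<lambda>s. snd l (g s)"] by metis
qed

text \<open>A derivative in one chart yields derivatives in all charts around \<open>g t\<close> by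
  the chain rule, so the values of \<open>vector_derivative\<close> in \<open>velocity\<close> are
  genuine. Comparing any two of these charts gives the compatibility condition of
  \<open>tangent_space\<close>.\<close>

lemma velocity_in_chart:
  assumes near: "\<And>l. l \<in> A \<Longrightarrow> g t \<in> fst l \<Longrightarrow> \<forall>\<^sub>F s in nhds t. g s \<in> fst l"
    and k: "k \<in> A" "g t \<in> fst k"
    and deriv: "((\<lambda>s. snd k (g s)) has_vector_derivative w) (at t)"
  shows "velocity A g t \<in> tangent_space A (g t)" and "velocity A g t k = w"
proof -
  have vel: "((\<lambda>s. snd l (g s)) has_vector_derivative velocity A g t l) (at t)"
    if l: "l \<in> A" "g t \<in> fst l" for l
  proof -
    have "((\<lambda>s. snd l (g s)) has_vector_derivative
        frechet_derivative (transition k l) (at (snd k (g t))) w) (at t)"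
      by (rule chart_change_vector_derivative[where t = t and g = g, OF k(1) l(1) k(2) l(2) near[OF k] deriv])
    then show ?thesis
      using l by (simp add: velocity_def o_def vector_derivative_at)
  qed
  show "velocity A g t k = w"
    using vector_derivative_unique_at[OF vel[OF k] deriv] .
  have "velocity A g t m = frechet_derivative (transition l m) (at (snd l (g t))) (velocity A g t l)"
    if lm: "l \<in> A" "m \<in> A" "g t \<in> fst l \<inter> fst m" for l m
  proof -
    have lt: "g t \<in> fst l" and mt: "g t \<in> fst m"
      using lm(3) by auto
    show ?thesis
      by (rule vector_derivative_unique_at[OF vel[OF lm(2) mt]
          chart_change_vector_derivative[where t = t and g = g, OF lm(1,2) lt mt near[OF lm(1) lt] vel[OF lm(1) lt]]])
  qed
  moreover have "\<And>l. \<not> (l \<in> A \<and> g t \<in> fst l) \<Longrightarrow> velocity A g t l = 0"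
    unfolding velocity_def by (rule if_not_P)
  ultimately show "velocity A g t \<in> tangent_space A (g t)"
    unfolding tangent_space_def by blast
qed

text \<open>The infimum is tested on the chart segment alone. If its speed should fail to be
  integrable, \<open>integral\<close> is \<open>0\<close> and the estimate still holds.\<close>

lemma finsler_dist_le:
  assumes F: "K \<ge> 0" "\<And>u v. u \<in> fst k \<Longrightarrow> v \<in> tangent_space A u \<Longrightarrow> snd k u \<in> ball a r \<Longrightarrow>
      F (u, v) \<le> K * norm (v k)"
    and k: "k \<in> A" "ball a r \<subseteq> snd k ` fst k"
    and q: "q \<in> fst k" "snd k q \<in> ball a r" and q': "q' \<in> fst k" "snd k q' \<in> ball a r"
  shows "finsler_dist X A F q q' \<le> ereal (K * norm (snd k q' - snd k q))"
proof -
  let ?w = "snd k q' - snd k q"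
  define \<sigma> where "\<sigma> s = snd k q + s *\<^sub>R ?w" for s :: real
  define \<gamma> where "\<gamma> s = inv_into (fst k) (snd k) (\<sigma> s)" for s
  \<comment> \<open>An open parameter set around the unit interval makes two-sided derivatives
    available at the endpoints as well. It contains the interval because the ball is convex.\<close>
  define J where "J = \<sigma> -` ball a r"
  have \<sigma>_cont: "continuous_on S \<sigma>" for S
    unfolding \<sigma>_def by (intro continuous_intros)
  have J: "open J" "{0..1} \<subseteq> J"
  proof -
    show "open J"
      unfolding J_def using \<sigma>_cont by (intro open_vimage) auto
    have "\<sigma> s \<in> ball a r" if "s \<in> {0..1}" for s
    proof -
      have "\<sigma> s = (1 - s) *\<^sub>R snd k q + s *\<^sub>R snd k q'"
        by (simp add: \<sigma>_def algebra_simps)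
      then show ?thesis
        using convexD[OF convex_ball q(2) q'(2), of "1 - s" s] that by simp
    qed
    then show "{0..1} \<subseteq> J"
      unfolding J_def by blast
  qed
  have \<gamma>: "\<gamma> s \<in> fst k" "snd k (\<gamma> s) = \<sigma> s" if "s \<in> J" for s
    using that k(2) unfolding J_def \<gamma>_def by (auto simp: inv_into_into f_inv_into_f subset_iff)
  have \<gamma>_cont: "continuous_map (top_of_set J) X \<gamma>"
  proof -
    have "continuous_map (top_of_set J) (top_of_set (snd k ` fst k)) \<sigma>"
      using \<sigma>_cont k(2) by (auto simp: J_def)
    then show ?thesis
      using continuous_map_compose[OF _ chart_inv_continuous[OF chart[OF k(1)]]]
      unfolding \<gamma>_def o_def by blast
  qed
  have near: "\<forall>\<^sub>F s in nhds t. \<gamma> s \<in> fst l" if "t \<in> J" "l \<in> A" "\<gamma> t \<in> fst l" for t l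
    by (rule continuous_map_eventually_nhds[OF \<gamma>_cont J(1) that(1) chart_openin[OF that(2)] that(3)])
  have deriv: "((\<lambda>s. snd k (\<gamma> s)) has_vector_derivative ?w) (at t)" if "t \<in> J" for t
  proof (rule has_vector_derivative_transform_within_open[OF _ J(1) that])
    show "(\<sigma> has_vector_derivative ?w) (at t)"
      unfolding \<sigma>_def by (auto intro!: derivative_eq_intros)
  qed (simp add: \<gamma>)
  have "C1_curve_on A \<gamma> 0 1"
    unfolding C1_curve_on_def
  proof
    fix l assume l: "l \<in> A"
    obtain T where T: "continuous_on (snd k ` (fst k \<inter> fst l)) T"
      "\<And>q. q \<in> fst k \<Longrightarrow> q \<in> fst l \<Longrightarrow>
        (transition k l has_derivative blinfun_apply (T (snd k q))) (at (snd k q))"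
      "\<And>q. q \<in> fst k \<Longrightarrow> q \<in> fst l \<Longrightarrow>
        frechet_derivative (transition k l) (at (snd k q)) = blinfun_apply (T (snd k q))"
      by (rule transition_frechet[OF k(1) l]) (rule that)
    show "\<exists>g'. (\<forall>t\<in>{0..1}. \<gamma> t \<in> fst l \<longrightarrow>
          ((snd l \<circ> \<gamma>) has_vector_derivative g' t) (at t within {0..1})) \<and>
        continuous_on {t \<in> {0..1}. \<gamma> t \<in> fst l} g'"
    \<comment> \<open>In chart \<open>k\<close> the segment has constant velocity \<open>?w\<close>,
      so in chart \<open>l\<close> the witness is the derivative of the transition map along the
      segment, applied to \<open>?w\<close>.\<close>
    proof (intro exI[of _ "\<lambda>t. blinfun_apply (T (\<sigma> t)) ?w"] conjI ballI impI)
      fix t :: real assume t: "t \<in> {0..1}" "\<gamma> t \<in> fst l"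
      then have tJ: "t \<in> J"
        using J(2) by blast
      have "((\<lambda>s. snd l (\<gamma> s)) has_vector_derivative
          frechet_derivative (transition k l) (at (snd k (\<gamma> t))) ?w) (at t)"
        by (rule chart_change_vector_derivative[where t = t and g = \<gamma>, OF k(1) l \<gamma>(1)[OF tJ] t(2)
              near[OF tJ k(1) \<gamma>(1)[OF tJ]] deriv[OF tJ]])
      then show "((snd l \<circ> \<gamma>) has_vector_derivative blinfun_apply (T (\<sigma> t)) ?w) (at t within {0..1})"
        using T(3)[OF \<gamma>(1)[OF tJ] t(2)] \<gamma>(2)[OF tJ]
        by (simp add: o_def has_vector_derivative_at_within)
    next
      have "\<sigma> t \<in> snd k ` (fst k \<inter> fst l)" if "t \<in> {0..1}" "\<gamma> t \<in> fst l" for t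
        using \<gamma>[of t] J(2) that by (metis IntI image_eqI subsetD)
      then have "continuous_on {t \<in> {0..1}. \<gamma> t \<in> fst l} (\<lambda>t. T (\<sigma> t))"
        by (intro continuous_on_compose2[OF T(1) \<sigma>_cont]) auto
      then show "continuous_on {t \<in> {0..1}. \<gamma> t \<in> fst l} (\<lambda>t. blinfun_apply (T (\<sigma> t)) ?w)"
        by (intro continuous_intros)
    qed
  qed
  moreover have "pathin X \<gamma>"
    unfolding pathin_def using continuous_map_from_subtopology_mono[OF \<gamma>_cont J(2)] .
  ultimately have path: "piecewise_C1_path X A \<gamma>"
    unfolding piecewise_C1_path_def
    \<comment> \<open>A single smooth piece, with break points \<open>0\<close> and
      \<open>1\<close>.\<close>
    by (intro conjI exI[of _ "1::nat"] exI[of _ "\<lambda>i::nat. real i"]) auto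
  have ends: "\<gamma> 0 = q" "\<gamma> 1 = q'"
    using q(1) q'(1) chart_inj[OF chart[OF k(1)]] by (auto simp: \<gamma>_def \<sigma>_def)
  have speed: "F (\<gamma> t, velocity A \<gamma> t) \<le> K * norm ?w" if "t \<in> {0..1}" for t
  proof -
    have t: "t \<in> J"
      using that J(2) by blast
    have "velocity A \<gamma> t \<in> tangent_space A (\<gamma> t)" "velocity A \<gamma> t k = ?w"
      using velocity_in_chart[of \<gamma> t, OF near[OF t] k(1) \<gamma>(1)[OF t] deriv[OF t]] by auto
    moreover have "snd k (\<gamma> t) \<in> ball a r"
      using \<gamma>(2)[OF t] t unfolding J_def by simp
    ultimately show ?thesis
      using F(2)[OF \<gamma>(1)[OF t]] by metis
  qed
  have "finsler_length A F \<gamma> \<le> K * norm ?w"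
  proof (cases "(\<lambda>t. F (\<gamma> t, velocity A \<gamma> t)) integrable_on {0..1}")
    case True
    have "integral {0..1} (\<lambda>t. F (\<gamma> t, velocity A \<gamma> t)) \<le> integral {0..1} (\<lambda>t::real. K * norm ?w)"
      by (rule integral_le[OF True _ speed]) auto
    then show ?thesis
      by (simp add: finsler_length_def)
  next
    case False
    then show ?thesis
      using F(1) by (simp add: finsler_length_def not_integrable_integral)
  qed
  moreover have "finsler_dist X A F q q' \<le> ereal (finsler_length A F \<gamma>)"
    unfolding finsler_dist_def by (rule INF_lower) (use path ends in simp)
  ultimately show ?thesis
    by (meson ereal_less_eq(3) order_trans)
qed

end

section \<open>Open submanifolds and the local estimate for the metric\<close>

text \<open>Restricting a chart changes the set in its \<open>inv_into\<close>, so restricted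
  transition maps are different functions. They agree with the old ones on the open coordinate image
  of the overlap within \<open>V\<close>, which is enough to inherit the derivatives.\<close>

lemma restrict_manifold:
  assumes "differentiable_manifold X A" "openin X V"
  shows "differentiable_manifold (subtopology X V) (restrict_atlas A V)"
proof -
  interpret C1_manifold X A
    by standard (rule assms(1))
  have ch: "is_chart (subtopology X V) (fst k \<inter> V, snd k)" if k: "k \<in> A" for k
  proof -
    have 1: "openin X (fst k \<inter> V)"
      using chart_openin[OF k] assms(2) by blast
    have 2: "open (snd k ` (fst k \<inter> V))"
      by (rule chart_open_image[OF chart[OF k] 1]) simp
    have "homeomorphic_map (subtopology X (fst k)) (top_of_set (snd k ` fst k)) (snd k)"
      using chart[OF k] unfolding is_chart_def by blast
    then have "homeomorphic_map (subtopology (subtopology X (fst k)) (fst k \<inter> V))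
        (subtopology (top_of_set (snd k ` fst k)) (snd k ` (fst k \<inter> V))) (snd k)"
      by (rule homeomorphic_map_subtopologies_alt)
        (use chart_inj[OF chart[OF k]] in \<open>auto simp: inj_on_def\<close>)
    moreover have "subtopology (subtopology X (fst k)) (fst k \<inter> V) =
        subtopology (subtopology X V) (fst k \<inter> V)"
      by (simp add: subtopology_subtopology Int_ac)
    moreover have "subtopology (top_of_set (snd k ` fst k)) (snd k ` (fst k \<inter> V)) =
        top_of_set (snd k ` (fst k \<inter> V))"
      by (simp add: subtopology_subtopology inf.absorb2 image_mono)
    ultimately have "homeomorphic_map (subtopology (subtopology X V) (fst k \<inter> V))
        (top_of_set (snd k ` (fst k \<inter> V))) (snd k)"
      by metis
    then show ?thesis
      unfolding is_chart_def fst_conv snd_conv using 1 2 assms(2)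
      by (simp add: openin_open_subtopology)
  qed
  have C1: "C1_on (transition (fst k \<inter> V, snd k) (fst l \<inter> V, snd l)) (snd k ` (fst k \<inter> fst l \<inter> V))"
    if k: "k \<in> A" and l: "l \<in> A" for k l
  proof -
    obtain D :: "'b \<Rightarrow> 'b \<Rightarrow>\<^sub>L 'b" where D: "continuous_on (snd k ` (fst k \<inter> fst l)) D"
      "\<And>q. q \<in> fst k \<Longrightarrow> q \<in> fst l \<Longrightarrow>
        (transition k l has_derivative blinfun_apply (D (snd k q))) (at (snd k q))"
      "\<And>q. q \<in> fst k \<Longrightarrow> q \<in> fst l \<Longrightarrow>
        frechet_derivative (transition k l) (at (snd k q)) = blinfun_apply (D (snd k q))"
      by (rule transition_frechet[OF k l]) (rule that)
    have op: "open (snd k ` (fst k \<inter> fst l \<inter> V))"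
      using chart_openin k l assms(2) by (intro chart_open_image[OF chart[OF k]] openin_Int) auto
    have "(transition (fst k \<inter> V, snd k) (fst l \<inter> V, snd l) has_derivative blinfun_apply (D x)) (at x)"
      if x: "x \<in> snd k ` (fst k \<inter> fst l \<inter> V)" for x
    proof (rule has_derivative_transform_within_open[OF _ op x])
      show "(transition k l has_derivative blinfun_apply (D x)) (at x)"
        using D(2) x by blast
      fix y assume "y \<in> snd k ` (fst k \<inter> fst l \<inter> V)"
      then obtain q where "q \<in> fst k" "q \<in> V" "y = snd k q"
        by blast
      then show "transition k l y = transition (fst k \<inter> V, snd k) (fst l \<inter> V, snd l) y"
        using transition_chart[OF chart[OF k], of q l]
          transition_chart[OF ch[OF k], of q "(fst l \<inter> V, snd l)"] by simp
    qed
    moreover have "continuous_on (snd k ` (fst k \<inter> fst l \<inter> V)) D"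
      by (rule continuous_on_subset[OF D(1)]) blast
    ultimately show ?thesis
      unfolding C1_on_def by blast
  qed
  have eq: "fst k \<inter> V \<inter> (fst l \<inter> V) = fst k \<inter> fst l \<inter> V" for k l :: "('a, 'b) chart"
    by blast
  show ?thesis
    unfolding differentiable_manifold_def restrict_atlas_def
  proof (intro conjI)
    show "Hausdorff_space (subtopology X V)" "\<exists>B :: 'b set. finite B \<and> span B = UNIV"
      using assms(1) Hausdorff_space_subtopology unfolding differentiable_manifold_def by blast+
    show "second_countable (subtopology X V)"
      using assms(1) second_countable_subtopology unfolding differentiable_manifold_def by blast
    have "(\<Union>k\<in>A. fst k) = topspace X"
      using assms(1) unfolding differentiable_manifold_def by blast
    then show "\<Union> (fst ` (\<lambda>k. (fst k \<inter> V, snd k)) ` A) = topspace (subtopology X V)"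
      by (auto simp: image_image)
    show "\<forall>k\<in>(\<lambda>k. (fst k \<inter> V, snd k)) ` A. is_chart (subtopology X V) k"
      using ch by blast
    show "\<forall>k\<in>(\<lambda>k. (fst k \<inter> V, snd k)) ` A. \<forall>l\<in>(\<lambda>k. (fst k \<inter> V, snd k)) ` A.
        C1_on (transition k l) (snd k ` (fst k \<inter> fst l))"
      unfolding ball_simps fst_conv snd_conv eq using C1 by blast
  qed
qed

text \<open>On \<open>V\<close> the Lipschitz constant \<open>c\<close> bounds \<open>c * d\<close>
  by the Finsler distance, and a chart segment bounds the latter by \<open>K\<close> times the
  coordinate distance. Together they give the factor \<open>K / c\<close>.\<close>

lemma locally_finsler_le_chart:
  assumes "differentiable_manifold X A" "locally_finsler X A d" "k \<in> A" "p \<in> fst k"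
  obtains W C where "openin X W" "p \<in> W" "W \<subseteq> fst k"
    and "\<And>q q'. q \<in> W \<Longrightarrow> q' \<in> W \<Longrightarrow> d q q' \<le> C * norm (snd k q' - snd k q)"
proof -
  interpret C1_manifold X A
    by standard (rule assms(1))
  have "p \<in> topspace X"
    using chart_topspace[OF chart[OF assms(3)] assms(4)] .
  then obtain V F where V: "openin X V" "p \<in> V"
    and F: "finsler_metric (subtopology X V) (restrict_atlas A V) F"
    and equiv: "lipschitz_equivalent_on V d (finsler_dist (subtopology X V) (restrict_atlas A V) F)"
    using assms(2) unfolding locally_finsler_def by blast
  obtain c where c: "c > 0" "\<And>x y. x \<in> V \<Longrightarrow> y \<in> V \<Longrightarrow>
      ereal (c * d x y) \<le> finsler_dist (subtopology X V) (restrict_atlas A V) F x y"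
    using equiv unfolding lipschitz_equivalent_on_def by blast
  interpret V: C1_manifold "subtopology X V" "restrict_atlas A V"
    by standard (rule restrict_manifold[OF assms(1) V(1)])
  define k' where "k' = (fst k \<inter> V, snd k)"
  have k': "k' \<in> restrict_atlas A V" "p \<in> fst k'" "snd k' = snd k" "fst k' = fst k \<inter> V"
    using assms(3,4) V(2) by (auto simp: k'_def restrict_atlas_def)
  obtain K r where K: "K > 0" "r > 0" "\<And>q v. q \<in> fst k' \<Longrightarrow>
      v \<in> tangent_space (restrict_atlas A V) q \<Longrightarrow> dist (snd k' q) (snd k' p) < r \<Longrightarrow>
      F (q, v) \<le> K * norm (v k')"
    by (rule V.finsler_le_norm[OF F k'(1,2)]) (rule that)
  have "open (snd k' ` fst k')"
    using V.chart[OF k'(1)] unfolding is_chart_def by blast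
  then obtain s where s: "s > 0" "ball (snd k p) s \<subseteq> snd k' ` fst k'"
    using k'(2,3) open_contains_ball by (metis image_eqI)
  \<comment> \<open>Within radius \<open>r\<close> the Finsler norm is bounded by \<open>K\<close>
    times the coordinate norm; within radius \<open>s\<close> coordinate segments stay in the image
    of the restricted chart and so lift to paths in \<open>V\<close>.\<close>
  define B where "B = ball (snd k p) (min r s)"
  define W where "W = {q \<in> fst k. snd k q \<in> B} \<inter> V"
  have "openin (subtopology X (fst k)) {q \<in> topspace (subtopology X (fst k)). snd k q \<in> B}"
    by (rule openin_continuous_map_preimage[OF chart_continuous[OF chart[OF assms(3)]]])
      (simp add: B_def)
  moreover have "topspace (subtopology X (fst k)) = fst k"
    using openin_subset[OF chart_openin[OF assms(3)]] by (rule topspace_subtopology_subset)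
  ultimately have "openin X {q \<in> fst k. snd k q \<in> B}"
    using openin_trans_full[OF _ chart_openin[OF assms(3)]] by metis
  then have W: "openin X W"
    unfolding W_def using V(1) by blast
  have bound: "d q q' \<le> K / c * norm (snd k q' - snd k q)" if q: "q \<in> W" "q' \<in> W" for q q'
  proof -
    have "finsler_dist (subtopology X V) (restrict_atlas A V) F q q'
        \<le> ereal (K * norm (snd k' q' - snd k' q))"
    proof (rule V.finsler_dist_le[where a = "snd k p" and r = "min r s"])
      fix u and v :: "('a, 'b) tangent"
      assume "u \<in> fst k'" "v \<in> tangent_space (restrict_atlas A V) u"
        "snd k' u \<in> ball (snd k p) (min r s)"
      then show "F (u, v) \<le> K * norm (v k')"
        using K(3) by (simp add: k'(3) dist_commute)
    qed (use K(1) k' s q in \<open>auto simp: W_def B_def subset_iff\<close>)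
    then have "ereal (c * d q q') \<le> ereal (K * norm (snd k' q' - snd k' q))"
      using c(2)[of q q'] q unfolding W_def by (meson IntD2 order_trans)
    then show ?thesis
      using c(1) k'(3) by (simp add: field_simps)
  qed
  show thesis
    by (rule that[OF W _ _ bound]) (use assms(4) V(2) K(2) s(1) in \<open>auto simp: W_def B_def\<close>)
qed

section \<open>Comparison of two curves with the same velocity\<close>

theorem lemma6p9:
  fixes X :: "'a topology"
    and A :: "('a, 'e::real_normed_vector) chart set"
    and d :: "'a \<Rightarrow> 'a \<Rightarrow> real"
    and p :: 'a and v :: "('a, 'e) tangent"
    and c \<eta> :: "real \<Rightarrow> 'a" and \<epsilon> l :: real
  assumes "differentiable_manifold X A"
    and "Metric_space (topspace X) d"
    and "locally_finsler X A d"
    and "p \<in> topspace X" and "v \<in> tangent_space A p"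
    and "\<epsilon> > 0"
    and "continuous_map (top_of_set {-\<epsilon><..<\<epsilon>}) X c"
    and "c 0 = p" and "differentiable_curve_at A c 0" and "velocity A c 0 = v"
    and "((\<lambda>t. d (c t) p / \<bar>t\<bar>) \<longlongrightarrow> l) (at 0)"
    and "continuous_map (top_of_set {-\<epsilon><..<\<epsilon>}) X \<eta>"
    and "\<eta> 0 = p" and "differentiable_curve_at A \<eta> 0" and "velocity A \<eta> 0 = v"
  shows "((\<lambda>t. d (\<eta> t) p / \<bar>t\<bar>) \<longlongrightarrow> l) (at 0)"
proof -
  interpret C1_manifold X A
    by standard (rule assms(1))
  interpret Metric_space "topspace X" d
    by (rule assms(2))
  obtain k where k: "k \<in> A" "p \<in> fst k"
    using assms(1,4) unfolding differentiable_manifold_def by blast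
  obtain W C where W: "openin X W" "p \<in> W" "W \<subseteq> fst k"
    "\<And>q q'. q \<in> W \<Longrightarrow> q' \<in> W \<Longrightarrow> d q q' \<le> C * norm (snd k q' - snd k q)"
    by (rule locally_finsler_le_chart[OF assms(1,3) k]) (rule that)
  have near: "\<forall>\<^sub>F t in at 0. g t \<in> W"
    if "continuous_map (top_of_set {-\<epsilon><..<\<epsilon>}) X g" "g 0 = p" for g
  proof -
    have "\<forall>\<^sub>F t in nhds 0. g t \<in> W"
      by (rule continuous_map_eventually_nhds[OF that(1) _ _ W(1)]) (use assms(6) that(2) W(2) in auto)
    then show ?thesis
      by (simp add: eventually_at_filter eventually_mono)
  qed
  have deriv: "((\<lambda>t. snd k (g t)) has_vector_derivative v k) (at 0)"
    if "g 0 = p" "differentiable_curve_at A g 0" "velocity A g 0 = v" for g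
  proof -
    have "(\<lambda>t. snd k (g t)) differentiable (at 0)"
      using that(1,2) k unfolding differentiable_curve_at_def o_def by blast
    moreover have "v k = vector_derivative (\<lambda>t. snd k (g t)) (at 0)"
      unfolding that(3)[symmetric] velocity_def o_def using that(1) k by simp
    ultimately show ?thesis
      using vector_derivative_works by metis
  qed
  let ?\<delta> = "\<lambda>t. snd k (\<eta> t) - snd k (c t)"
  have "(?\<delta> has_vector_derivative v k - v k) (at 0)"
    using deriv[of \<eta>] deriv[of c] assms(8-10,13-15) by (intro has_vector_derivative_diff) auto
  \<comment> \<open>The derivative of \<open>?\<delta>\<close> at \<open>0\<close> is zero, and
    \<open>?\<delta> 0 = 0\<close> because both curves start at \<open>p\<close>; the difference
    quotient defining the derivative is therefore exactly this expression.\<close>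
  then have "((\<lambda>t. norm (?\<delta> t) / \<bar>t\<bar>) \<longlongrightarrow> 0) (at 0)"
    unfolding has_vector_derivative_def has_derivative_at using assms(8,13) by simp
  then have "((\<lambda>t. C * (norm (?\<delta> t) / \<bar>t\<bar>)) \<longlongrightarrow> 0) (at 0)"
    by (rule tendsto_mult_right_zero)
  moreover have "\<forall>\<^sub>F t in at 0. norm (d (\<eta> t) p / \<bar>t\<bar> - d (c t) p / \<bar>t\<bar>) \<le> C * (norm (?\<delta> t) / \<bar>t\<bar>)"
    using near[OF assms(7,8)] near[OF assms(12,13)]
  proof eventually_elim
    case (elim t)
    have X: "c t \<in> topspace X" "\<eta> t \<in> topspace X"
      using elim openin_subset[OF W(1)] by auto
    \<comment> \<open>The reverse triangle inequality leaves only the distance between the two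
      curves, to which the local chart estimate applies.\<close>
    have "\<bar>d (\<eta> t) p - d (c t) p\<bar> \<le> d (c t) (\<eta> t)"
      using triangle[OF X(1,2) assms(4)] triangle[OF X(2,1) assms(4)] commute[of "\<eta> t" "c t"]
      by linarith
    also have "\<dots> \<le> C * norm (?\<delta> t)"
      by (rule W(4)[OF elim])
    finally have "\<bar>d (\<eta> t) p - d (c t) p\<bar> / \<bar>t\<bar> \<le> C * norm (?\<delta> t) / \<bar>t\<bar>"
      by (rule divide_right_mono) simp
    then show ?case
      by (simp add: diff_divide_distrib[symmetric] abs_divide)
  qed
  ultimately have "((\<lambda>t. d (\<eta> t) p / \<bar>t\<bar> - d (c t) p / \<bar>t\<bar>) \<longlongrightarrow> 0) (at 0)"
    by (rule Lim_null_comparison[rotated])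
  from tendsto_add[OF this assms(11)] show ?thesis
    by simp
qed

end
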